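(* $$\pi_{K_4}(\mathcal{T}_4)\leq 2-2\sqrt{\frac23}=0.36701\ldots .$$
   Context: Graphs are finite and simple; $K_4$ is the complete graph on $4$ vertices. Let $H$ be a host graph. A (weighted) $H$-partite graph is a graph $G$ together with a canonical partition $V(G)=\bigsqcup_{x\in V(H)}V_x$ and a weight function $w:V(G)\to[0,1]$ such that (1) $\sum_{v\in V_x}w(v)=1$ for each $x\in V(H)$; (2) every edge of $G$ joins a vertex of $V_x$ to a vertex of $V_y$ for some $xy\in E(H)$. For $xy\in E(H)$ put $\alpha_{xy}:=\sum_{u\in V_x,\,v\in V_y}w(u)w(v)\mathbb{1}_{uv\in E(G)}$; the $H$-partite density of $G$ is $d_H(G):=\min\{\alpha_{xy}: xy\in E(H)\}$. A transversal of $G$ is a subgraph of $G$ induced by a set of vertices meeting each part $V_x$ in exactly one vertex (it is naturally viewed as a spanning subgraph of $H$). For a family $\mathcal{F}$ of graphs, $G$ has $\mathcal{F}$-free transversals if no transversal of $G$ contains a member of $\mathcal{F}$ as a subgraph, and $$\pi_H(\mathcal{F}):=\sup\{d_H(G): G\text{ is an }H\text{-partite graph with }\mathcal{F}\text{-free transversals}\}.$$ $\mathcal{T}_4$ denotes the family of all trees on $4$ vertices; thus for a $4$-vertex host graph $H$, $G$ has $\mathcal{T}_4$-free transversals if and only if no transversal of $G$ is connected.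
   Formalization: The value 2-2√(2/3) is 0.3670068…, so the printed "= 0.36701…" is not its decimal expansion but a rounding; it is stated as |2-2√(2/3) - 0.36701| ≤ 5·10⁻⁶. The bound on π_{K_4}(𝒯_4) is unchanged. *)

theory Defs
  imports
    Complex_Main
    "HOL-Library.Disjoint_Sets"
    "Graph_Theory.Graph_Theory"
begin

text \<open>
  A finite simple graph is a \<^locale>\<open>pair_graph\<close>: a finite loop-free symmetric digraph whose arcs are
  pairs of vertices. An undirected edge is represented by its two opposite arcs.

  \<^const>\<open>Digraph_Component.tree\<close> is not usable for such graphs, since its acyclicity
  condition counts the two arcs of a single edge as a closed cycle of length 2. The cycles of the
  underlying undirected graph are exactly the directed cycles of length at least 3.
\<close>

definition undirected_tree :: "'v pair_pre_digraph \<Rightarrow> bool" where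
  "undirected_tree T \<longleftrightarrow>
     pair_graph T \<and> Digraph_Component.connected (with_proj T) \<and>
     \<not> (\<exists>p. pre_digraph.cycle (with_proj T) p \<and> 3 \<le> length p)"

text \<open>Every finite graph has an isomorphic copy with vertices in \<^typ>\<open>nat\<close>.\<close>

definition trees_on :: "nat \<Rightarrow> nat pair_pre_digraph set" where
  "trees_on n = {T. undirected_tree T \<and> card (pverts T) = n}"

locale weighted_partite_graph = H: pair_graph H + G: pair_graph G
  for H :: "'h pair_pre_digraph" and G :: "'v pair_pre_digraph" +
  fixes V :: "'h \<Rightarrow> 'v set" and w :: "'v \<Rightarrow> real"
  assumes parts_cover: "pverts G = (\<Union>x\<in>pverts H. V x)"
    and parts_disjoint: "disjoint_family_on V (pverts H)"
    and weight_range: "v \<in> pverts G \<Longrightarrow> w v \<in> {0..1}"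
    and weight_part: "x \<in> pverts H \<Longrightarrow> (\<Sum>v\<in>V x. w v) = 1"
    and arcs_between_parts:
      "(u, v) \<in> parcs G \<Longrightarrow> \<exists>(x, y)\<in>parcs H. u \<in> V x \<and> v \<in> V y"

definition pair_density ::
    "'v pair_pre_digraph \<Rightarrow> ('h \<Rightarrow> 'v set) \<Rightarrow> ('v \<Rightarrow> real) \<Rightarrow> 'h \<Rightarrow> 'h \<Rightarrow> real" where
  "pair_density G V w x y =
     (\<Sum>u\<in>V x. \<Sum>v\<in>V y. w u * w v * of_bool ((u, v) \<in> parcs G))"

text \<open>
  Both orientations of an edge of \<^term>\<open>H\<close> contribute the same value, because \<^term>\<open>G\<close> is symmetric.
\<close>

definition partite_density ::
    "'h pair_pre_digraph \<Rightarrow> 'v pair_pre_digraph \<Rightarrow> ('h \<Rightarrow> 'v set) \<Rightarrow> ('v \<Rightarrow> real) \<Rightarrow> real" where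
  "partite_density H G V w = Min ((\<lambda>(x, y). pair_density G V w x y) ` parcs H)"

definition transversals ::
    "'h pair_pre_digraph \<Rightarrow> 'v pair_pre_digraph \<Rightarrow> ('h \<Rightarrow> 'v set) \<Rightarrow> ('v, 'v \<times> 'v) pre_digraph set" where
  "transversals H G V =
     {with_proj G \<restriction> S | S. S \<subseteq> pverts G \<and> (\<forall>x\<in>pverts H. \<exists>!v. v \<in> S \<inter> V x)}"

text \<open>Subgraph containment, up to isomorphism and not necessarily induced.\<close>

definition contains_copy :: "('a, 'b) pre_digraph \<Rightarrow> ('c, 'd) pre_digraph \<Rightarrow> bool" where
  "contains_copy G F \<longleftrightarrow> (\<exists>S. subgraph S G \<and> digraph_iso F S)"

definition free_transversals ::
    "'f pair_pre_digraph set \<Rightarrow> 'h pair_pre_digraph \<Rightarrow> 'v pair_pre_digraph \<Rightarrow> ('h \<Rightarrow> 'v set) \<Rightarrow> bool"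
  where
  "free_transversals \<F> H G V \<longleftrightarrow>
     (\<forall>T\<in>transversals H G V. \<forall>F\<in>\<F>. \<not> contains_copy T (with_proj F))"

text \<open>
  The supremum ranges over all finite \<^term>\<open>H\<close>-partite graphs up to isomorphism; their vertices are
  taken in \<^typ>\<open>nat\<close>. As a supremum of reals it is meaningful when \<^term>\<open>H\<close> has an edge and some
  \<^term>\<open>H\<close>-partite graph has \<open>\<F>\<close>-free transversals (e.g. an edgeless one, if every member
  of \<open>\<F>\<close> has an edge); the densities then lie in the interval from 0 to 1.
\<close>

definition partite_turan_density :: "'h pair_pre_digraph \<Rightarrow> 'f pair_pre_digraph set \<Rightarrow> real" where
  "partite_turan_density H \<F> =
     Sup {partite_density H G V w | (G :: nat pair_pre_digraph) V w.
            weighted_partite_graph H G V w \<and> free_transversals \<F> H G V}"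

end

theory Submission
  imports Defs
begin

text \<open>
  Let \<open>G\<close> be a \<open>K\<^sub>4\<close>-partite graph without connected transversals whose pair densities are all at
  least \<open>d\<close>. A spanning tree on four vertices is a star or a path, so connected transversals are
  excluded by two local conditions. No vertex has neighbours in all three other parts
  (\<open>star_free\<close>), and if \<open>u\<close> and \<open>v\<close> are adjacent, then they do not have neighbours in the two
  remaining parts, \<open>u\<close> in one and \<open>v\<close> in the other (\<open>path_free\<close>).

  Write \<open>s x y\<close> for the weight of the vertices of \<open>V x\<close> that have a neighbour in \<open>V y\<close>. An edge
  between \<open>V x\<close> and \<open>V y\<close> joins two such vertices, so the density of the pair is at most
  \<open>s x y * s y x\<close>. The star condition gives \<open>s x y + s x z + s x t \<le> 2\<close>.

  Assume \<open>d > 1 / 3\<close>, as there is nothing to prove otherwise, and fix a part \<open>c\<close>. By averaging, some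
  \<open>v\<close> in \<open>V c\<close> has weighted degrees with sum at least \<open>3 * d > 1\<close> into the other parts. It misses one
  of them, say \<open>m\<close>, so it has neighbours in both others, \<open>x\<close> and \<open>y\<close>. By the path condition its
  neighbours in \<open>V x\<close> and in \<open>V y\<close> have no neighbours in \<open>V m\<close>. Hence \<open>s x m + s y m \<le> 2 - 3 * d\<close>.
  On the other side, \<open>s m c \<ge> d\<close> leaves only \<open>s m x + s m y \<le> 2 - d\<close>. Both \<open>s x m * s m x\<close> and
  \<open>s y m * s m y\<close> are at least \<open>d\<close>, and the Cauchy-Schwarz inequality yields
  \<open>4 * d \<le> (2 - 3 * d) * (2 - d)\<close>, that is \<open>(2 - d)\<^sup>2 \<ge> 8 / 3\<close>.
\<close>

section \<open>Trees given by a parent function\<close>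

text \<open>
  The root is \<open>0\<close>, and \<open>p\<close> is meant to send every other vertex to a smaller one. Stars
  (\<open>p i = 0\<close>) and paths (\<open>p i = i - 1\<close>) are then trees for the same reason.
\<close>

definition parent_tree :: "nat \<Rightarrow> (nat \<Rightarrow> nat) \<Rightarrow> nat pair_pre_digraph" where
  "parent_tree n p =
     \<lparr>pverts = {..<n}, parcs = (\<Union>i\<in>{0<..<n}. {(i, p i), (p i, i)})\<rparr>"

lemma parent_tree_simps [simp]:
  "pverts (parent_tree n p) = {..<n}"
  "(u, v) \<in> parcs (parent_tree n p) \<longleftrightarrow>
     (0 < u \<and> u < n \<and> v = p u) \<or> (0 < v \<and> v < n \<and> u = p v)"
  by (auto simp: parent_tree_def)

lemma pair_graph_parent_tree:
  assumes "\<And>i. \<lbrakk>0 < i; i < n\<rbrakk> \<Longrightarrow> p i < i"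
  shows "pair_graph (parent_tree n p)"
proof
  have "p i < n" if "0 < i" "i < n" for i
    using assms[OF that] that(2) by linarith
  then show "fst e \<in> pverts (parent_tree n p)" "snd e \<in> pverts (parent_tree n p)"
    if "e \<in> parcs (parent_tree n p)" for e
    using that by (cases e; auto)+
  show "finite (parcs (parent_tree n p))"
    by (simp add: parent_tree_def)
  show "fst e \<noteq> snd e" if "e \<in> parcs (parent_tree n p)" for e
    using that assms[of "fst e"] assms[of "snd e"] by (cases e) auto
  show "symmetric (with_proj (parent_tree n p))"
    by (auto simp: symmetric_def intro!: symI)
qed simp

lemma connected_parent_tree:
  assumes "0 < n" and parent: "\<And>i. \<lbrakk>0 < i; i < n\<rbrakk> \<Longrightarrow> p i < i"
  shows "Digraph_Component.connected (with_proj (parent_tree n p))"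
proof -
  define R where "R = parcs (mk_symmetric (with_proj (parent_tree n p)))"
  have arc: "(i, p i) \<in> R" if "0 < i" "i < n" for i
    using that by (auto simp: R_def parcs_mk_symmetric intro!: bexI[of _ "(i, p i)"])
  have "sym R"
    by (auto simp: R_def parcs_mk_symmetric intro!: symI)
  then have sym: "sym (rtrancl_on {..<n} R)"
    by (rule rtrancl_on_sym)
  have root: "(i, 0) \<in> rtrancl_on {..<n} R" if "i < n" for i
    using that
  proof (induction i rule: less_induct)
    case (less i)
    show ?case
    proof (cases "i = 0")
      case False
      then have "p i < i"
        using parent less.prems by simp
      then have "(p i, 0) \<in> rtrancl_on {..<n} R"
        using less by simp
      moreover have "(i, p i) \<in> R"
        using False arc less.prems by simp
      ultimately show ?thesis
        using less.prems by (auto intro: converse_rtrancl_on_into_rtrancl_on)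
    qed (use \<open>0 < n\<close> in simp)
  qed
  have "(i, j) \<in> rtrancl_on {..<n} R" if "i < n" "j < n" for i j
    using root[OF that(1)] symD[OF sym root[OF that(2)]] by (rule rtrancl_on_trans)
  then show ?thesis
    using \<open>0 < n\<close>
    by (auto simp: connected_def strongly_connected_def reachable_def R_def)
qed

lemma pcas_nth:
  assumes "pcas u p v" "i < length p"
  shows "snd (p ! i) = (if Suc i = length p then v else fst (p ! Suc i))"
  using assms
proof (induction p arbitrary: u i)
  case (Cons e es)
  show ?case
  proof (cases i)
    case 0
    then show ?thesis
      using Cons.prems by (cases es) auto
  next
    case (Suc k)
    then show ?thesis
      using Cons.prems Cons.IH[of "snd e" k] by simp
  qed
qed simp

text \<open>
  The two neighbours of the largest vertex \<open>M\<close> of a cycle are smaller than \<open>M\<close>, so both are the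
  parent of \<open>M\<close>. But on a cycle of length at least three they are distinct.
\<close>

lemma no_long_cycle_parent_tree:
  assumes parent: "\<And>i. \<lbrakk>0 < i; i < n\<rbrakk> \<Longrightarrow> p i < i"
    and cycle: "pre_digraph.cycle (with_proj (parent_tree n p)) c"
  shows "length c < 3"
proof (rule ccontr)
  assume "\<not> length c < 3"
  then have len: "3 \<le> length c"
    by simp
  interpret T: pair_graph "parent_tree n p"
    using parent by (rule pair_graph_parent_tree)
  obtain u where walk: "set c \<subseteq> parcs (parent_tree n p)" "pcas u c u"
    and dist: "distinct (tl (pawalk_verts u c))"
    using cycle by (auto simp: T.cycle_def T.awalk_def)
  have "T.awalk_verts u c = fst (hd c) # map snd c"
    using T.awalk_verts_conv'[OF walk(2)] len by auto
  then have dist: "distinct (map snd c)"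
    using dist by simp
  \<comment> \<open>Arc indices are cyclic: arc \<open>i\<close> enters \<open>M\<close>, arc \<open>next_idx i\<close> leaves it, arc \<open>h\<close> precedes both.\<close>
  define next_idx where "next_idx i = (if Suc i = length c then 0 else Suc i)" for i
  have "fst (c ! 0) = u"
    using walk(2) len by (cases c) auto
  then have step: "snd (c ! i) = fst (c ! next_idx i)" if "i < length c" for i
    using pcas_nth[OF walk(2) that] by (simp add: next_idx_def)
  have next_lt: "next_idx i < length c" if "i < length c" for i
    using that len by (auto simp: next_idx_def)
  define M where "M = Max (snd ` set c)"
  have "set c \<noteq> {}"
    using len by auto
  then have "M \<in> snd ` set c"
    unfolding M_def by (intro Max_in) auto
  then obtain i where i: "i < length c" "snd (c ! i) = M"
    by (metis imageE in_set_conv_nth)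
  have le_M: "snd (c ! k) \<le> M" if "k < length c" for k
    unfolding M_def using that by (intro Max_ge) auto
  have snd_inj: "snd (c ! k) \<noteq> snd (c ! l)" if "k < length c" "l < length c" "k \<noteq> l" for k l
    using dist that by (auto simp: distinct_conv_nth)
  define h where "h = (if i = 0 then length c - 1 else i - 1)"
  have h: "h < length c" "next_idx h = i" "h \<noteq> next_idx i" "h \<noteq> i" "next_idx i \<noteq> i"
    using i(1) len by (auto simp: h_def next_idx_def split: if_splits)
  have arc: "(fst (c ! k), snd (c ! k)) \<in> parcs (parent_tree n p)" if "k < length c" for k
    using walk(1) that by (auto dest: nth_mem)
  have smaller_is_parent: "b = p a" if "b < a" "(a, b) \<in> parcs (parent_tree n p)" for a b
    using that parent[of b] by auto
  have "snd (c ! next_idx i) = p M"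
    using arc[OF next_lt[OF i(1)]] step[OF i(1)] i(2) le_M[OF next_lt[OF i(1)]]
      snd_inj[OF next_lt[OF i(1)] i(1) h(5)]
    by (intro smaller_is_parent) auto
  moreover have "snd (c ! h) = p M"
  proof (rule smaller_is_parent)
    show "snd (c ! h) < M"
      using le_M[OF h(1)] snd_inj[OF h(1) i(1) h(4)] i(2) by simp
    have "(snd (c ! h), M) \<in> parcs (parent_tree n p)"
      using arc[OF i(1)] step[OF h(1)] i(2) h(2) by simp
    then show "(M, snd (c ! h)) \<in> parcs (parent_tree n p)"
      by (rule T.arcs_symmetric)
  qed
  ultimately show False
    using snd_inj[OF h(1) next_lt[OF i(1)] h(3)] by simp
qed

lemma parent_tree_in_trees_on:
  assumes "0 < n" "\<And>i. \<lbrakk>0 < i; i < n\<rbrakk> \<Longrightarrow> p i < i"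
  shows "parent_tree n p \<in> trees_on n"
  using pair_graph_parent_tree[of n p] connected_parent_tree[of n p]
    no_long_cycle_parent_tree[of n p] assms
  by (force simp: trees_on_def undirected_tree_def)

section \<open>Trees in transversals\<close>

lemma contains_copyI:
  assumes "wf_digraph (with_proj F)" "wf_digraph (with_proj G \<restriction> S)"
    and "inj_on f (pverts F)" "f ` pverts F \<subseteq> S"
    and "\<And>u v. (u, v) \<in> parcs F \<Longrightarrow> (f u, f v) \<in> parcs G"
  shows "contains_copy (with_proj G \<restriction> S) (with_proj F)"
proof -
  interpret F: wf_digraph "with_proj F" by fact
  define iso where
    "iso = \<lparr>iso_verts = f, iso_arcs = map_prod f f, iso_head = snd, iso_tail = fst\<rparr>"
  have ends: "u \<in> pverts F" "v \<in> pverts F" if "(u, v) \<in> parcs F" for u v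
    using F.wellformed[of "(u, v)"] that by auto
  have "inj_on (map_prod f f) (parcs F)"
    using assms(3) ends by (auto simp: inj_on_def)
  then have iso: "F.digraph_isomorphism iso"
    using assms(1,3) by (simp add: F.digraph_isomorphism_def iso_def)
  have "subgraph (app_iso iso (with_proj F)) (with_proj G \<restriction> S)"
  proof (rule subgraphI)
    show "wf_digraph (app_iso iso (with_proj F))"
      using iso by (rule F.wf_digraphI_app_iso)
    show "arcs (app_iso iso (with_proj F)) \<subseteq> arcs (with_proj G \<restriction> S)"
      using assms(4,5) ends by (fastforce simp: iso_def)
  qed (use assms in \<open>auto simp: iso_def compatible_def\<close>)
  then show ?thesis
    using iso unfolding contains_copy_def digraph_iso_def by blast
qed

text \<open>
  The vertex \<open>f i\<close> plays the role of the tree vertex \<open>i\<close>. The images are distinct because they lie in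
  different parts, so \<open>f\<close> embeds the tree into the transversal that it spans.
\<close>

lemma (in weighted_partite_graph) transversal_tree_not_free:
  assumes "bij_betw x {..<n} (pverts H)" "0 < n"
    and f: "\<And>i. i < n \<Longrightarrow> f i \<in> V (x i)"
    and parent: "\<And>i. \<lbrakk>0 < i; i < n\<rbrakk> \<Longrightarrow> p i < i"
    and arc: "\<And>i. \<lbrakk>0 < i; i < n\<rbrakk> \<Longrightarrow> (f (p i), f i) \<in> parcs G"
  shows "\<not> free_transversals (trees_on n) H G V"
proof
  assume free: "free_transversals (trees_on n) H G V"
  define S where "S = f ` {..<n}"
  have x: "x i \<in> pverts H" if "i < n" for i
    using assms(1) that by (auto simp: bij_betw_def)
  have same: "i = j" if "i < n" "j < n" "f i \<in> V (x j)" for i j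
  proof -
    have "x i = x j"
      using disjoint_family_onD[OF parts_disjoint x[OF that(1)] x[OF that(2)]] f[OF that(1)] that(3)
      by blast
    then show ?thesis
      using assms(1) that by (auto simp: bij_betw_def inj_on_def)
  qed
  have sub: "S \<subseteq> pverts G"
    using f x parts_cover by (fastforce simp: S_def)
  moreover have "\<exists>!v. v \<in> S \<inter> V y" if y: "y \<in> pverts H" for y
  proof -
    obtain j where j: "j < n" "y = x j"
      using assms(1) y by (auto simp: bij_betw_def)
    show ?thesis
    proof
      show "f j \<in> S \<inter> V y"
        using j f by (simp add: S_def)
      show "v = f j" if "v \<in> S \<inter> V y" for v
        using that j same by (auto simp: S_def)
    qed
  qed
  ultimately have "with_proj G \<restriction> S \<in> transversals H G V"
    unfolding transversals_def by blast
  moreover have "parent_tree n p \<in> trees_on n"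
    using assms(2) parent by (rule parent_tree_in_trees_on)
  moreover have "contains_copy (with_proj G \<restriction> S) (with_proj (parent_tree n p))"
  proof (rule contains_copyI[where f = f])
    interpret T: pair_graph "parent_tree n p"
      using parent by (rule pair_graph_parent_tree)
    show "wf_digraph (with_proj (parent_tree n p))"
      by (rule T.wf_digraph)
    show "wf_digraph (with_proj G \<restriction> S)"
      by (rule G.wellformed_induce_subgraph)
    show "inj_on f (pverts (parent_tree n p))"
      using same f by (auto simp: inj_on_def)
    show "(f u, f v) \<in> parcs G" if "(u, v) \<in> parcs (parent_tree n p)" for u v
      using that arc G.arcs_symmetric by auto
  qed (simp add: S_def)
  ultimately show False
    using free by (auto simp: free_transversals_def)
qed

lemma nth_bij_betw_four:
  assumes "distinct [x, y, z, t]" "A = {x, y, z, t}"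
  shows "bij_betw ((!) [x, y, z, t]) {..<4} A"
  using bij_betw_nth[OF assms(1), of "{..<4}" A] assms(2) by simp

lemma less_four_iff: "i < (4::nat) \<longleftrightarrow> i = 0 \<or> i = 1 \<or> i = 2 \<or> i = 3"
  by arith

context weighted_partite_graph
begin

lemma star_free:
  assumes "free_transversals (trees_on 4) H G V"
    and "distinct [x, y, z, t]" "pverts H = {x, y, z, t}"
    and "u \<in> V x" "a \<in> V y" "b \<in> V z" "c \<in> V t"
    and "(u, a) \<in> parcs G" "(u, b) \<in> parcs G" "(u, c) \<in> parcs G"
  shows False
proof -
  have "\<not> free_transversals (trees_on 4) H G V"
  proof (rule transversal_tree_not_free)
    show "bij_betw ((!) [x, y, z, t]) {..<4} (pverts H)"
      using assms(2,3) by (rule nth_bij_betw_four)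
    show "[u, a, b, c] ! i \<in> V ([x, y, z, t] ! i)" if "i < 4" for i
      using that assms(4-7) by (auto simp: less_four_iff)
    show "([u, a, b, c] ! 0, [u, a, b, c] ! i) \<in> parcs G" if "0 < i" "i < 4" for i
      using that assms(8-10) by (auto simp: less_four_iff)
  qed auto
  then show False
    using assms(1) by simp
qed

lemma path_free:
  assumes "free_transversals (trees_on 4) H G V"
    and "distinct [x, y, z, t]" "pverts H = {x, y, z, t}"
    and "a \<in> V x" "b \<in> V y" "c \<in> V z" "d \<in> V t"
    and "(a, b) \<in> parcs G" "(b, c) \<in> parcs G" "(c, d) \<in> parcs G"
  shows False
proof -
  have "\<not> free_transversals (trees_on 4) H G V"
  proof (rule transversal_tree_not_free[where p = "\<lambda>i. i - 1"])
    show "bij_betw ((!) [x, y, z, t]) {..<4} (pverts H)"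
      using assms(2,3) by (rule nth_bij_betw_four)
    show "[a, b, c, d] ! i \<in> V ([x, y, z, t] ! i)" if "i < 4" for i
      using that assms(4-7) by (auto simp: less_four_iff)
    show "([a, b, c, d] ! (i - 1), [a, b, c, d] ! i) \<in> parcs G" if "0 < i" "i < 4" for i
      using that assms(8-10) by (auto simp: less_four_iff)
  qed auto
  then show False
    using assms(1) by simp
qed

end

section \<open>Weights of vertices with a neighbour in a given part\<close>

definition sees :: "'v pair_pre_digraph \<Rightarrow> ('h \<Rightarrow> 'v set) \<Rightarrow> 'v \<Rightarrow> 'h \<Rightarrow> bool" where
  "sees G V u y \<longleftrightarrow> (\<exists>v\<in>V y. (u, v) \<in> parcs G)"

definition seeing_weight ::
    "'v pair_pre_digraph \<Rightarrow> ('h \<Rightarrow> 'v set) \<Rightarrow> ('v \<Rightarrow> real) \<Rightarrow> 'h \<Rightarrow> 'h \<Rightarrow> real" where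
  "seeing_weight G V w x y = (\<Sum>u\<in>V x. w u * of_bool (sees G V u y))"

definition part_degree ::
    "'v pair_pre_digraph \<Rightarrow> ('h \<Rightarrow> 'v set) \<Rightarrow> ('v \<Rightarrow> real) \<Rightarrow> 'v \<Rightarrow> 'h \<Rightarrow> real" where
  "part_degree G V w u y = (\<Sum>v\<in>V y. w v * of_bool ((u, v) \<in> parcs G))"

context weighted_partite_graph
begin

lemma finite_part: "x \<in> pverts H \<Longrightarrow> finite (V x)"
  using G.pair_finite_verts parts_cover by (metis UN_upper finite_subset)

lemma weight_nonneg: "\<lbrakk>x \<in> pverts H; v \<in> V x\<rbrakk> \<Longrightarrow> 0 \<le> w v"
  using weight_range parts_cover by fastforce

lemma seeing_weight_nonneg: "x \<in> pverts H \<Longrightarrow> 0 \<le> seeing_weight G V w x y"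
  by (auto simp: seeing_weight_def weight_nonneg intro!: sum_nonneg)

lemma seeing_weight_le_one: "x \<in> pverts H \<Longrightarrow> seeing_weight G V w x y \<le> 1"
  unfolding seeing_weight_def weight_part[symmetric]
  by (intro sum_mono) (auto simp: weight_nonneg)

lemma part_degree_le_one: "y \<in> pverts H \<Longrightarrow> part_degree G V w u y \<le> 1"
  unfolding part_degree_def weight_part[symmetric]
  by (intro sum_mono) (auto simp: weight_nonneg)

lemma part_degree_eq_0: "\<not> sees G V u y \<Longrightarrow> part_degree G V w u y = 0"
  by (auto simp: part_degree_def sees_def intro!: sum.neutral)

lemma pair_density_eq_part_degree:
  "pair_density G V w x y = (\<Sum>u\<in>V x. w u * part_degree G V w u y)"
  by (simp add: pair_density_def part_degree_def sum_distrib_left mult.assoc)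

text \<open>
  Keeping the factor from both ends is essential: the final inequality multiplies the weights seen
  from the two sides of a pair.
\<close>

lemma pair_density_le_seeing_weights:
  assumes "x \<in> pverts H" "y \<in> pverts H"
  shows "pair_density G V w x y \<le> seeing_weight G V w x y * seeing_weight G V w y x"
  unfolding pair_density_def seeing_weight_def sum_product
proof (intro sum_mono)
  fix u v assume uv: "u \<in> V x" "v \<in> V y"
  have "sees G V u y" "sees G V v x" if "(u, v) \<in> parcs G"
    using that uv G.arcs_symmetric by (auto simp: sees_def)
  then show "w u * w v * of_bool ((u, v) \<in> parcs G)
      \<le> w u * of_bool (sees G V u y) * (w v * of_bool (sees G V v x))"
    using uv assms by (auto simp: weight_nonneg)
qed

lemma seeing_weight_sum_le_2:
  assumes "x \<in> pverts H"
    and "\<And>u. u \<in> V x \<Longrightarrow> \<not> (sees G V u y \<and> sees G V u z \<and> sees G V u t)"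
  shows "seeing_weight G V w x y + seeing_weight G V w x z + seeing_weight G V w x t \<le> 2"
proof -
  have "seeing_weight G V w x y + seeing_weight G V w x z + seeing_weight G V w x t
      = (\<Sum>u\<in>V x. w u * (of_bool (sees G V u y) + of_bool (sees G V u z) + of_bool (sees G V u t)))"
    by (simp add: seeing_weight_def sum.distrib distrib_left)
  also have "\<dots> \<le> (\<Sum>u\<in>V x. w u * 2)"
    using assms by (intro sum_mono mult_left_mono) (auto simp: weight_nonneg)
  also have "\<dots> = 2"
    using weight_part[OF assms(1)] by (simp flip: sum_distrib_right)
  finally show ?thesis .
qed

text \<open>
  The neighbours of \<open>v\<close> in \<open>V x\<close> and the vertices of \<open>V x\<close> with a neighbour in \<open>V y\<close> are disjoint sets
  inside a part of weight one.
\<close>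

lemma seeing_weight_le_one_minus_part_degree:
  assumes "x \<in> pverts H"
    and "\<And>u. \<lbrakk>u \<in> V x; (v, u) \<in> parcs G\<rbrakk> \<Longrightarrow> \<not> sees G V u y"
  shows "seeing_weight G V w x y \<le> 1 - part_degree G V w v x"
proof -
  have "seeing_weight G V w x y + part_degree G V w v x
      = (\<Sum>u\<in>V x. w u * (of_bool (sees G V u y) + of_bool ((v, u) \<in> parcs G)))"
    by (simp add: seeing_weight_def part_degree_def sum.distrib distrib_left)
  also have "\<dots> \<le> (\<Sum>u\<in>V x. w u * 1)"
    using assms by (intro sum_mono mult_left_mono) (auto simp: weight_nonneg)
  also have "\<dots> = 1"
    using weight_part[OF assms(1)] by simp
  finally show ?thesis by simp
qed

text \<open>
  The three densities at \<open>c\<close> add up to the average of the weighted degree over \<open>V c\<close>, and some vertex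
  reaches the average.
\<close>

lemma obtain_vertex_of_large_degree:
  assumes "c \<in> pverts H"
    and "d \<le> pair_density G V w c x" "d \<le> pair_density G V w c y" "d \<le> pair_density G V w c z"
  obtains v where "v \<in> V c"
    "3 * d \<le> part_degree G V w v x + part_degree G V w v y + part_degree G V w v z"
proof (rule ccontr)
  let ?D = "\<lambda>v. part_degree G V w v x + part_degree G V w v y + part_degree G V w v z"
  assume "\<not> thesis"
  with that have less: "?D v < 3 * d" if "v \<in> V c" for v
    using that by force
  have "3 * d \<le> (\<Sum>v\<in>V c. w v * ?D v)"
    using assms(2-4) by (simp add: pair_density_eq_part_degree sum.distrib distrib_left)
  also have "\<dots> < (\<Sum>v\<in>V c. w v * (3 * d))"
  proof (rule sum_strict_mono_ex1)
    show "finite (V c)"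
      using assms(1) by (rule finite_part)
    show "\<forall>v\<in>V c. w v * ?D v \<le> w v * (3 * d)"
      by (intro ballI mult_left_mono less_imp_le[OF less] weight_nonneg[OF assms(1)])
    obtain v where "v \<in> V c" "w v \<noteq> 0"
      using weight_part[OF assms(1)] by (metis sum.neutral zero_neq_one)
    moreover have "0 < w v"
      using weight_nonneg[OF assms(1)] calculation by force
    ultimately show "\<exists>v\<in>V c. w v * ?D v < w v * (3 * d)"
      using less by (intro bexI[of _ v] mult_strict_left_mono)
  qed
  also have "\<dots> = 3 * d"
    using weight_part[OF assms(1)] by (simp flip: sum_distrib_right)
  finally show False by simp
qed

end

section \<open>The density bound\<close>

text \<open>
  This is the Cauchy-Schwarz inequality
  \<open>(sqrt (A * p) + sqrt (B * q))\<^sup>2 \<le> (A + B) * (p + q)\<close> without the roots: the mixed terms \<open>A * q\<close>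
  and \<open>B * p\<close> have product at least \<open>d\<^sup>2\<close>, hence sum at least \<open>2 * d\<close>.
\<close>

lemma four_mult_le_sum_mult_sum:
  fixes A B p q d :: real
  assumes "0 \<le> d" "0 \<le> A" "0 \<le> B" "0 \<le> p" "0 \<le> q" "d \<le> A * p" "d \<le> B * q"
  shows "4 * d \<le> (A + B) * (p + q)"
proof -
  have "d * d \<le> (A * p) * (B * q)"
    using assms by (intro mult_mono) auto
  moreover have "(A * q + B * p)\<^sup>2 = (A * q - B * p)\<^sup>2 + 4 * ((A * p) * (B * q))"
    by (simp add: power2_eq_square algebra_simps)
  moreover have "0 \<le> (A * q - B * p)\<^sup>2"
    by simp
  moreover have "(2 * d)\<^sup>2 = 4 * (d * d)"
    by (simp add: power2_eq_square)
  ultimately have "(2 * d)\<^sup>2 \<le> (A * q + B * p)\<^sup>2"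
    by linarith
  then have "2 * d \<le> A * q + B * p"
    by (rule power2_le_imp_le) (use assms in auto)
  then show ?thesis
    using assms(6,7) by (simp add: algebra_simps)
qed

lemma le_two_minus_two_sqrt:
  fixes d :: real
  assumes "4 * d \<le> (2 - 3 * d) * (2 - d)" "d \<le> 2"
  shows "d \<le> 2 - 2 * sqrt (2 / 3)"
proof -
  have "(2 * sqrt (2 / 3))\<^sup>2 \<le> (2 - d)\<^sup>2"
    using assms(1) by (simp add: power_mult_distrib) (simp add: power2_eq_square algebra_simps)
  then have "2 * sqrt (2 / 3) \<le> 2 - d"
    by (rule power2_le_imp_le) (use assms(2) in simp)
  then show ?thesis by simp
qed

lemma two_minus_two_sqrt_approx: "\<bar>(2 - 2 * sqrt (2 / 3)) - 0.36701\<bar> \<le> (5 / 10 ^ 6 :: real)"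
proof -
  have "sqrt (2 / 3) \<le> 0.816497"
    by (rule real_le_lsqrt) (simp_all add: power2_eq_square)
  moreover have "0.816496 \<le> sqrt (2 / 3)"
    by (rule real_le_rsqrt) (simp add: power2_eq_square)
  ultimately show ?thesis
    by (auto simp: abs_le_iff)
qed

context weighted_partite_graph
begin

text \<open>
  A vertex \<open>v\<close> that reaches degree \<open>3 * d > 1\<close> in two parts has neighbours in both, since a single
  part contributes at most one. A neighbour \<open>u\<close> of \<open>v\<close> in \<open>V x\<close> with a neighbour in \<open>V m\<close> would give a
  path from \<open>V y\<close> through \<open>v\<close> and \<open>u\<close> to \<open>V m\<close>, and likewise with \<open>x\<close> and \<open>y\<close> exchanged. So the pairs
  formed by \<open>m\<close> with \<open>x\<close> and with \<open>y\<close> must reach density \<open>d\<close> with little weight on the side of \<open>x\<close>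
  and \<open>y\<close>.
\<close>

lemma density_bound_at_missed_part:
  assumes free: "free_transversals (trees_on 4) H G V"
    and parts: "distinct [c, m, x, y]" "pverts H = {c, m, x, y}"
    and dens: "\<And>a b. \<lbrakk>a \<in> pverts H; b \<in> pverts H; a \<noteq> b\<rbrakk> \<Longrightarrow> d \<le> pair_density G V w a b"
    and d: "1 / 3 < d"
    and v: "v \<in> V c" "3 * d \<le> part_degree G V w v x + part_degree G V w v y"
  shows "4 * d \<le> (2 - 3 * d) * (2 - d)"
proof -
  let ?s = "seeing_weight G V w" and ?deg = "part_degree G V w v"
  have neq: "c \<noteq> m" "c \<noteq> x" "c \<noteq> y" "m \<noteq> x" "m \<noteq> y" "x \<noteq> y"
    using parts(1) by auto
  have mem: "c \<in> pverts H" "m \<in> pverts H" "x \<in> pverts H" "y \<in> pverts H"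
    using parts(2) by auto
  have dens_le: "d \<le> ?s a b * ?s b a" if "a \<in> pverts H" "b \<in> pverts H" "a \<noteq> b" for a b
    using dens[OF that] pair_density_le_seeing_weights[OF that(1,2)] by linarith
  have "?deg x \<noteq> 0" "?deg y \<noteq> 0"
    using v(2) d part_degree_le_one[OF mem(3), of v] part_degree_le_one[OF mem(4), of v] by auto
  then have v_sees: "sees G V v x" "sees G V v y"
    using part_degree_eq_0 by blast+
  have "?s x m \<le> 1 - ?deg x"
  proof (rule seeing_weight_le_one_minus_part_degree[OF mem(3)])
    fix u assume u: "u \<in> V x" "(v, u) \<in> parcs G"
    obtain a where a: "a \<in> V y" "(v, a) \<in> parcs G"
      using v_sees(2) by (auto simp: sees_def)
    show "\<not> sees G V u m"
    proof
      assume "sees G V u m"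
      then obtain b where "b \<in> V m" "(u, b) \<in> parcs G"
        by (auto simp: sees_def)
      then show False
        using path_free[OF free, of y c x m a v u b] a u v(1) neq parts(2) G.arcs_symmetric
        by auto
    qed
  qed
  moreover have "?s y m \<le> 1 - ?deg y"
  proof (rule seeing_weight_le_one_minus_part_degree[OF mem(4)])
    fix u assume u: "u \<in> V y" "(v, u) \<in> parcs G"
    obtain a where a: "a \<in> V x" "(v, a) \<in> parcs G"
      using v_sees(1) by (auto simp: sees_def)
    show "\<not> sees G V u m"
    proof
      assume "sees G V u m"
      then obtain b where "b \<in> V m" "(u, b) \<in> parcs G"
        by (auto simp: sees_def)
      then show False
        using path_free[OF free, of x c y m a v u b] a u v(1) neq parts(2) G.arcs_symmetric
        by auto
    qed
  qed
  ultimately have AB: "?s x m + ?s y m \<le> 2 - 3 * d"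
    using v(2) by linarith
  have "?s m c + ?s m x + ?s m y \<le> 2"
  proof (rule seeing_weight_sum_le_2[OF mem(2)])
    show "\<not> (sees G V u c \<and> sees G V u x \<and> sees G V u y)" if "u \<in> V m" for u
      using star_free[OF free, of m c x y u] that neq parts(2) by (auto simp: sees_def)
  qed
  moreover have "d \<le> ?s m c"
    using dens_le[OF mem(2,1)] neq(1) seeing_weight_nonneg[OF mem(2), of c]
      seeing_weight_le_one[OF mem(1), of m] mult_left_le[of "?s c m" "?s m c"] by auto
  ultimately have pq: "?s m x + ?s m y \<le> 2 - d"
    by linarith
  have nonneg: "0 \<le> ?s x m" "0 \<le> ?s y m" "0 \<le> ?s m x" "0 \<le> ?s m y"
    using mem by (simp_all add: seeing_weight_nonneg)
  have "4 * d \<le> (?s x m + ?s y m) * (?s m x + ?s m y)"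
    using d nonneg dens_le[OF mem(3,2)] dens_le[OF mem(4,2)] neq
    by (intro four_mult_le_sum_mult_sum) auto
  also have "\<dots> \<le> (2 - 3 * d) * (2 - d)"
    using AB pq nonneg by (intro mult_mono) auto
  finally show ?thesis .
qed

lemma density_bound:
  assumes free: "free_transversals (trees_on 4) H G V"
    and card: "card (pverts H) = 4"
    and dens: "\<And>a b. \<lbrakk>a \<in> pverts H; b \<in> pverts H; a \<noteq> b\<rbrakk> \<Longrightarrow> d \<le> pair_density G V w a b"
  shows "d \<le> 2 - 2 * sqrt (2 / 3)"
proof (cases "1 / 3 < d")
  case False
  moreover have "sqrt (2 / 3) \<le> 5 / 6"
    by (rule real_le_lsqrt) (simp_all add: power2_eq_square)
  ultimately show ?thesis
    by linarith
next
  case True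
  obtain xs where xs: "set xs = pverts H" "distinct xs"
    using finite_distinct_list[OF H.pair_finite_verts] by blast
  then have "length xs = 4"
    using card distinct_card by fastforce
  then obtain c x y z where "xs = [c, x, y, z]"
    by (auto simp: numeral_eq_Suc length_Suc_conv)
  then have parts: "distinct [c, x, y, z]" "pverts H = {c, x, y, z}"
    using xs by auto
  then obtain v where v: "v \<in> V c"
    "3 * d \<le> part_degree G V w v x + part_degree G V w v y + part_degree G V w v z"
    using obtain_vertex_of_large_degree[of c d x y z] dens by auto
  note bound = density_bound_at_missed_part[OF free _ _ dens True v(1)]
  have "\<not> (sees G V v x \<and> sees G V v y \<and> sees G V v z)"
    using star_free[OF free parts v(1)] by (auto simp: sees_def)
  then consider "\<not> sees G V v x" | "\<not> sees G V v y" | "\<not> sees G V v z"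
    by blast
  then have "4 * d \<le> (2 - 3 * d) * (2 - d)"
  proof cases
    case 1
    then show ?thesis
      using bound[of x y z] parts v(2) by (auto simp: part_degree_eq_0)
  next
    case 2
    then show ?thesis
      using bound[of y x z] parts v(2) by (auto simp: part_degree_eq_0)
  next
    case 3
    then show ?thesis
      using bound[of z x y] parts v(2) by (auto simp: part_degree_eq_0)
  qed
  moreover have "d \<le> 2"
    using v(2) part_degree_le_one[of x v] part_degree_le_one[of y v] part_degree_le_one[of z v]
      parts(2) by auto
  ultimately show ?thesis
    by (rule le_two_minus_two_sqrt)
qed

end

section \<open>The supremum\<close>

lemma undirected_tree_has_arc:
  assumes "T \<in> trees_on n" "2 \<le> n"
  shows "parcs T \<noteq> {}"
proof
  assume no_arc: "parcs T = {}"
  have "finite (pverts T)" "\<not> card (pverts T) \<le> Suc 0"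
    using assms by (auto simp: trees_on_def intro: card_ge_0_finite)
  then obtain u v where "u \<in> pverts T" "v \<in> pverts T" "u \<noteq> v"
    by (auto simp: card_le_Suc0_iff_eq)
  then have "(u, v) \<in> rtrancl_on (pverts T) {}"
    using assms(1) no_arc
    by (auto simp: trees_on_def undirected_tree_def connected_def strongly_connected_def
        reachable_def parcs_mk_symmetric)
  then show False
    using \<open>u \<noteq> v\<close> by (auto elim: rtrancl_on.cases)
qed

text \<open>
  The supremum of the empty set of reals is unspecified, so the upper bound on the supremum needs
  a witness: the edgeless graph with a single vertex in each part.
\<close>

lemma ex_tree_free_partite_graph:
  assumes "pair_graph H" "2 \<le> n"
  shows "\<exists>(G :: nat pair_pre_digraph) V w.
    weighted_partite_graph H G V w \<and> free_transversals (trees_on n) H G V"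
proof -
  interpret H: pair_graph H by fact
  obtain f :: "_ \<Rightarrow> nat" where f: "inj_on f (pverts H)"
    using finite_imp_inj_to_nat_seg[OF H.pair_finite_verts] by blast
  define G where "G = \<lparr>pverts = f ` pverts H, parcs = {}\<rparr>"
  interpret G: pair_graph G
    by unfold_locales (auto simp: G_def symmetric_def sym_def H.pair_finite_verts)
  have "weighted_partite_graph H G (\<lambda>x. {f x}) (\<lambda>_. 1)"
    using f by unfold_locales (auto simp: G_def disjoint_family_on_def inj_on_def)
  moreover have "\<not> contains_copy (with_proj G \<restriction> S) (with_proj F)" if "F \<in> trees_on n" for F S
    using undirected_tree_has_arc[OF that assms(2)]
    by (auto simp: contains_copy_def digraph_iso_def subgraph_def G_def)
  ultimately show ?thesis
    by (auto simp: free_transversals_def transversals_def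
        intro!: exI[of _ G] exI[of _ "\<lambda>x. {f x}"] exI[of _ "\<lambda>_. 1"])
qed

theorem theorem3p3:
  fixes H :: "'h pair_pre_digraph"
  assumes "complete_digraph 4 (with_proj H)"
  shows "partite_turan_density H (trees_on 4) \<le> 2 - 2 * sqrt (2 / 3)
    \<and> \<bar>(2 - 2 * sqrt (2 / 3)) - 0.36701\<bar> \<le> 5 / 10 ^ 6"
proof
  have H: "pair_graph H" "card (pverts H) = 4"
    and arcs: "parcs H = {(u, v). u \<in> pverts H \<and> v \<in> pverts H \<and> u \<noteq> v}"
    using assms by (auto simp: complete_digraph_def intro: pair_graphI_graph)
  show "partite_turan_density H (trees_on 4) \<le> 2 - 2 * sqrt (2 / 3)"
    unfolding partite_turan_density_def
  proof (rule cSup_least)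
    show "{partite_density H G V w | (G :: nat pair_pre_digraph) V w.
        weighted_partite_graph H G V w \<and> free_transversals (trees_on 4) H G V} \<noteq> {}"
      using ex_tree_free_partite_graph[OF H(1), of 4] by auto
  next
    fix d
    assume "d \<in> {partite_density H G V w | (G :: nat pair_pre_digraph) V w.
        weighted_partite_graph H G V w \<and> free_transversals (trees_on 4) H G V}"
    then obtain G :: "nat pair_pre_digraph" and V w where
      d: "d = partite_density H G V w" and G: "weighted_partite_graph H G V w"
      and free: "free_transversals (trees_on 4) H G V"
      by blast
    interpret weighted_partite_graph H G V w by fact
    show "d \<le> 2 - 2 * sqrt (2 / 3)"
    proof (rule density_bound[OF free H(2)])
      show "d \<le> pair_density G V w a b" if "a \<in> pverts H" "b \<in> pverts H" "a \<noteq> b" for a b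
        unfolding d partite_density_def
        using that arcs H.pair_finite_arcs by (intro Min_le) (auto intro!: rev_image_eqI[of "(a, b)"])
    qed
  qed
qed (rule two_minus_two_sqrt_approx)

end
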